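(* Let $K_4^{(3)-}$ denote the $3$-graph on $4$ vertices with exactly $3$ edges. For an integer $n\ge 3$ let \[d_{\star}=d_\star(n)=\frac{1}{6}\left(\sqrt{13n^2-72n+108}-n+6\right).\] Then for every odd integer $n$, \[\frac{n-1}{2}\lfloor d_{\star}\rfloor\le c_1(n,K_4^{(3)-})\le \left\lfloor \frac{n-1}{2}d_{\star}\right\rfloor.\] In particular, $c_1(K_4^{(3)-})=\frac{\sqrt{13}-1}{6}$.
   Context: A $3$-graph is a $3$-uniform hypergraph. For a $3$-graph $G$ and a vertex $v$, $\deg(v)$ is the number of edges containing $v$, and the minimum vertex degree is $\delta_1(G)=\min_v \deg(v)$. For a $3$-graph $F$, a $3$-graph $G$ has an $F$-covering if every vertex of $G$ is contained in a copy of $F$ (a subhypergraph isomorphic to $F$) in $G$. The $1$-degree covering threshold is $c_1(n,F)=\max\{\delta_1(G): v(G)=n,\ G \text{ has no } F\text{-covering}\}$, and the $1$-degree covering density is $c_1(F)=\lim_{n\to\infty} c_1(n,F)/\binom{n-1}{2}$. *)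

theory Defs
  imports Complex_Main
begin

text \<open>A hypergraph is given by its vertex set and its edge set.\<close>

type_synonym 'a hgraph = "'a set \<times> 'a set set"

abbreviation verts :: "'a hgraph \<Rightarrow> 'a set" where
  "verts G \<equiv> fst G"

abbreviation edges :: "'a hgraph \<Rightarrow> 'a set set" where
  "edges G \<equiv> snd G"

definition three_graph :: "'a hgraph \<Rightarrow> bool" where
  "three_graph G \<longleftrightarrow>
     finite (verts G) \<and> (\<forall>e\<in>edges G. e \<subseteq> verts G \<and> card e = 3)"

definition vdegree :: "'a hgraph \<Rightarrow> 'a \<Rightarrow> nat" where
  "vdegree G v = card {e \<in> edges G. v \<in> e}"

definition min_vdegree :: "'a hgraph \<Rightarrow> nat" where
  "min_vdegree G = Min (vdegree G ` verts G)"

definition subhgraph :: "'a hgraph \<Rightarrow> 'a hgraph \<Rightarrow> bool" where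
  "subhgraph H G \<longleftrightarrow> three_graph H \<and> verts H \<subseteq> verts G \<and> edges H \<subseteq> edges G"

definition hgraph_iso :: "'a hgraph \<Rightarrow> 'b hgraph \<Rightarrow> bool" where
  "hgraph_iso H F \<longleftrightarrow>
     (\<exists>f. bij_betw f (verts H) (verts F) \<and> (\<lambda>e. f ` e) ` edges H = edges F)"

definition has_covering :: "'b hgraph \<Rightarrow> 'a hgraph \<Rightarrow> bool" where
  "has_covering F G \<longleftrightarrow>
     (\<forall>v\<in>verts G. \<exists>H. subhgraph H G \<and> hgraph_iso H F \<and> v \<in> verts H)"

text \<open>Every finite 3-graph is isomorphic to one whose vertices are natural numbers, so it
  suffices to let \<open>G\<close> range over these.  For \<open>n \<ge> 1\<close> and \<open>F\<close> with at least one edge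
  the set below is finite and nonempty, hence \<open>Max\<close> is a genuine maximum.\<close>

definition cov_threshold :: "nat \<Rightarrow> 'b hgraph \<Rightarrow> nat" where
  "cov_threshold n F =
     Max {min_vdegree G | G :: nat hgraph.
            three_graph G \<and> card (verts G) = n \<and> \<not> has_covering F G}"

definition cov_ratio :: "'b hgraph \<Rightarrow> nat \<Rightarrow> real" where
  "cov_ratio F n = real (cov_threshold n F) / real ((n - 1) choose 2)"

definition cov_density :: "'b hgraph \<Rightarrow> real" where
  "cov_density F = lim (cov_ratio F)"

definition K4_minus :: "nat hgraph" where
  "K4_minus = ({0, 1, 2, 3}, {{0, 1, 2}, {0, 1, 3}, {0, 2, 3}})"

definition d_star :: "nat \<Rightarrow> real" where
  "d_star n = (1 / 6) * (sqrt (13 * (real n)\<^sup>2 - 72 * real n + 108) - real n + 6)"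

end

theory Submission
  imports Defs
begin

text \<open>
  If the vertex \<open>x\<close> is not covered, its link graph \<open>L\<close> on the other \<open>N = n - 1\<close> vertices is
  triangle-free and no edge avoiding \<open>x\<close> contains two edges of \<open>L\<close>; conversely, \<open>L\<close> together with all
  triples containing at most one edge of \<open>L\<close> leaves \<open>x\<close> uncovered.  In the latter 3-graph twice the
  degree of \<open>v\<close> is \<open>(N - 1)(N - 2) + 5 d(v) - d(v)^2\<close> minus twice the sum of \<open>d(u)\<close> over the
  \<open>L\<close>-neighbours \<open>u\<close> of \<open>v\<close>.  If \<open>D\<close> is the average degree of \<open>L\<close>, then \<open>x\<close> has degree \<open>N D / 2\<close>, while
  by convexity twice the average degree of the other vertices is at most
  \<open>(N - 1)(N - 2) + 5 D - 3 D^2\<close>; the two bounds agree exactly at \<open>D = d_star n\<close>.  A regular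
  bipartite \<open>L\<close> of degree \<open>d\<close> at most \<open>d_star n\<close>, with one isolated vertex if \<open>n\<close> is even, gives the
  lower bound.
\<close>

section \<open>Counting edges of a link by ordered pairs\<close>

text \<open>Every unordered pair comes from exactly two ordered ones: \<open>sym\<close> supplies
  the second, and \<open>irrefl\<close> rules out the diagonal, where the fibre would be a
  singleton.\<close>

lemma card_sym_irrefl:
  assumes "finite R" "sym R" "irrefl R"
  shows "card R = 2 * card ((\<lambda>(u, w). {u, w}) ` R)"
proof -
  let ?f = "\<lambda>(u, w). {u, w}"
  have fibre: "card {p \<in> R. ?f p = e} = 2" if e: "e \<in> ?f ` R" for e
  proof -
    obtain u w where uw: "(u, w) \<in> R" "e = {u, w}" using e by auto
    then have "(w, u) \<in> R" "u \<noteq> w" using assms(2,3) unfolding sym_def irrefl_def by blast+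
    with uw have "{p \<in> R. ?f p = e} = {(u, w), (w, u)}" by (auto simp: doubleton_eq_iff)
    then show ?thesis using \<open>u \<noteq> w\<close> by simp
  qed
  have "card R = (\<Sum>e\<in>?f ` R. card {p \<in> R. ?f p = e})"
    using sum.image_gen[OF \<open>finite R\<close>, of "\<lambda>_. 1::nat" ?f] by simp
  also have "\<dots> = (\<Sum>e\<in>?f ` R. 2)" using fibre by (intro sum.cong) auto
  finally show ?thesis by simp
qed

lemma three_graph_edge_distinct:
  assumes "three_graph G" "{a, b, c} \<in> edges G"
  shows "a \<noteq> b" "a \<noteq> c" "b \<noteq> c" "a \<in> verts G" "b \<in> verts G" "c \<in> verts G"
proof -
  have "\<forall>e\<in>edges G. e \<subseteq> verts G \<and> card e = 3"
    using assms(1) unfolding three_graph_def by simp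
  then have *: "{a, b, c} \<subseteq> verts G \<and> card {a, b, c} = 3" using assms(2) by (rule bspec)
  then show "a \<in> verts G" "b \<in> verts G" "c \<in> verts G" by auto
  have "card {p, q} \<noteq> 3" for p q :: 'a by (cases "p = q") simp_all
  from this[of b c] this[of a b] this[of c b] *
  show "a \<noteq> b" "a \<noteq> c" "b \<noteq> c" by (auto simp: insert_commute)
qed

lemma three_graph_finite_edges:
  assumes "three_graph G"
  shows "finite (edges G)"
  using assms finite_subset[of "edges G" "Pow (verts G)"] unfolding three_graph_def by blast

text \<open>Deleting \<open>v\<close> maps the edges at \<open>v\<close> bijectively to the
  unordered pairs of its link, and each pair is counted in both orders. Degrees can thus be computed
  as cardinalities of relations.\<close>

lemma card_link_pairs:
  assumes G: "three_graph G"
  shows "card {(u, w). {v, u, w} \<in> edges G} = 2 * vdegree G v"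
proof -
  let ?R = "{(u, w). {v, u, w} \<in> edges G}"
  let ?P = "(\<lambda>(u, w). {u, w}) ` ?R"
  note dist = three_graph_edge_distinct[OF G]
  have "?R \<subseteq> verts G \<times> verts G" using dist(5,6) by auto
  moreover have "finite (verts G)" using G unfolding three_graph_def by simp
  ultimately have "finite ?R" by (simp add: finite_subset)
  moreover have "sym ?R" by (auto simp: sym_def insert_commute)
  moreover have "irrefl ?R" using dist(3)[of v u u for u] by (auto simp: irrefl_def)
  ultimately have R: "card ?R = 2 * card ?P" by (rule card_sym_irrefl)
  have inj: "inj_on (insert v) ?P"
  proof (rule inj_onI)
    fix p q assume "p \<in> ?P" "q \<in> ?P" and eq: "insert v p = insert v q"
    have "v \<notin> r" if "r \<in> ?P" for r
      using that dist(1)[of v v] dist(2)[of v _ v] by auto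
    then have "v \<notin> p" "v \<notin> q" using \<open>p \<in> ?P\<close> \<open>q \<in> ?P\<close> by (simp_all only: not_False_eq_True)
    with eq show "p = q" by (simp add: insert_ident)
  qed
  have img: "insert v ` ?P = {e \<in> edges G. v \<in> e}"
  proof (intro equalityI subsetI)
    fix e assume "e \<in> {e \<in> edges G. v \<in> e}"
    then have e: "e \<in> edges G" "v \<in> e" by auto
    then have "card e = 3" using G unfolding three_graph_def by simp
    then have "card (e - {v}) = 2" using e by simp
    then obtain u w where "e - {v} = {u, w}" by (auto simp: card_2_iff)
    then have *: "e = insert v {u, w}" using e(2) by auto
    then have "(u, w) \<in> ?R" using e(1) by simp
    then have "{u, w} \<in> ?P" by force
    with * show "e \<in> insert v ` ?P" by (rule image_eqI)
  qed auto
  have "card ?P = vdegree G v" unfolding vdegree_def img[symmetric] card_image[OF inj] ..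
  then show ?thesis using R by (simp only:)
qed

lemma vdegree_mono:
  assumes "three_graph H" "edges G \<subseteq> edges H"
  shows "vdegree G v \<le> vdegree H v"
  unfolding vdegree_def
  using assms three_graph_finite_edges[OF assms(1)] by (intro card_mono) auto

section \<open>Coverings by $K_4^{(3)-}$\<close>

text \<open>In the right-hand side \<open>a\<close> is the vertex lying in all three edges of the
  copy, and \<open>{b, c, d}\<close> is the triple left out. Distinctness of the four vertices
  follows from the edges having three elements.\<close>

lemma has_covering_K4_minus_iff:
  assumes G: "three_graph G"
  shows "has_covering K4_minus G \<longleftrightarrow>
    (\<forall>v\<in>verts G. \<exists>a b c d. v \<in> {a, b, c, d} \<and>
       {a, b, c} \<in> edges G \<and> {a, b, d} \<in> edges G \<and> {a, c, d} \<in> edges G)"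
proof -
  have "(\<exists>H. subhgraph H G \<and> hgraph_iso H K4_minus \<and> v \<in> verts H) \<longleftrightarrow>
    (\<exists>a b c d. v \<in> {a, b, c, d} \<and>
       {a, b, c} \<in> edges G \<and> {a, b, d} \<in> edges G \<and> {a, c, d} \<in> edges G)" for v
  proof
    assume "\<exists>H. subhgraph H G \<and> hgraph_iso H K4_minus \<and> v \<in> verts H"
    then obtain H f where H: "subhgraph H G" "v \<in> verts H"
      and f: "bij_betw f (verts H) (verts K4_minus)" "(\<lambda>e. f ` e) ` edges H = edges K4_minus"
      unfolding hgraph_iso_def by blast
    define g where "g = inv_into (verts H) f"
    have gf: "g ` f ` e = e" if "e \<in> edges H" for e
    proof -
      have "e \<subseteq> verts H" using H(1) that unfolding subhgraph_def three_graph_def by blast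
      then show ?thesis unfolding g_def
        using f(1) by (meson bij_betw_imp_inj_on inv_into_image_cancel)
    qed
    have edge: "g ` e \<in> edges G" if e: "e \<in> edges K4_minus" for e
    proof -
      have "e \<in> (\<lambda>e. f ` e) ` edges H" using e f(2) by simp
      then obtain e' where "e' \<in> edges H" "f ` e' = e" by blast
      then show ?thesis using gf[of e'] H(1) unfolding subhgraph_def by auto
    qed
    have "verts H = g ` verts K4_minus"
      using f(1) unfolding g_def by (metis bij_betw_imp_surj_on bij_betw_inv_into)
    then have "v \<in> {g 0, g 1, g 2, g 3}" using H(2) unfolding K4_minus_def by auto
    moreover have "{g 0, g 1, g 2} \<in> edges G" "{g 0, g 1, g 3} \<in> edges G"
      "{g 0, g 2, g 3} \<in> edges G"
      using edge[of "{0, 1, 2}"] edge[of "{0, 1, 3}"] edge[of "{0, 2, 3}"]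
      unfolding K4_minus_def by simp_all
    ultimately show "\<exists>a b c d. v \<in> {a, b, c, d} \<and>
       {a, b, c} \<in> edges G \<and> {a, b, d} \<in> edges G \<and> {a, c, d} \<in> edges G" by blast
  next
    assume "\<exists>a b c d. v \<in> {a, b, c, d} \<and>
       {a, b, c} \<in> edges G \<and> {a, b, d} \<in> edges G \<and> {a, c, d} \<in> edges G"
    then obtain a b c d where v: "v \<in> {a, b, c, d}"
      and e: "{a, b, c} \<in> edges G" "{a, b, d} \<in> edges G" "{a, c, d} \<in> edges G" by blast
    note dist = three_graph_edge_distinct[OF G e(1)] three_graph_edge_distinct[OF G e(2)]
      three_graph_edge_distinct[OF G e(3)]
    define H where "H = ({a, b, c, d}, {{a, b, c}, {a, b, d}, {a, c, d}})"
    \<comment> \<open>The last branch is the label of \<open>d\<close>. The vertex \<open>a\<close>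
      goes to 0, which lies in all three edges of \<open>K4_minus\<close>.\<close>
    define f where "f = (\<lambda>p. if p = a then 0 else if p = b then 1 else if p = c then 2 else (3::nat))"
    have f: "f a = 0" "f b = 1" "f c = 2" "f d = 3" using dist by (auto simp: f_def)
    have "subhgraph H G"
      unfolding subhgraph_def three_graph_def H_def using dist e by (simp add: card_insert_if)
    moreover have "hgraph_iso H K4_minus"
      unfolding hgraph_iso_def
    proof (intro exI conjI)
      show "bij_betw f (verts H) (verts K4_minus)"
        unfolding bij_betw_def H_def K4_minus_def inj_on_def by (simp add: f)
      show "(\<lambda>e. f ` e) ` edges H = edges K4_minus"
        unfolding H_def K4_minus_def by (simp add: f)
    qed
    ultimately show "\<exists>H. subhgraph H G \<and> hgraph_iso H K4_minus \<and> v \<in> verts H"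
      using v unfolding H_def by auto
  qed
  then show ?thesis unfolding has_covering_def by simp
qed

section \<open>The largest 3-graph with a prescribed link\<close>

text \<open>Two edges of \<open>A\<close> inside a triple share a vertex \<open>p\<close>, so the
  condition on \<open>e\<close> says that \<open>e\<close> contains at most one edge of
  \<open>A\<close>.\<close>

definition link_extension :: "'a \<Rightarrow> 'a set \<Rightarrow> 'a rel \<Rightarrow> 'a hgraph" where
  "link_extension x V A =
     (insert x V,
      {{x, u, w} | u w. (u, w) \<in> A} \<union>
      {e. e \<subseteq> V \<and> card e = 3 \<and> (\<forall>p\<in>e. \<forall>q\<in>e. \<forall>r\<in>e. (p, q) \<in> A \<and> (p, r) \<in> A \<longrightarrow> q = r)})"

text \<open>Serves both bounds: for the upper one \<open>A\<close> is the link of an uncovered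
  vertex \<open>x\<close> of an arbitrary 3-graph, for the lower one it is an explicit bipartite
  graph.\<close>

locale triangle_free_graph =
  fixes V :: "'a set" and A :: "'a rel" and x :: 'a
  assumes finite_V: "finite V"
    and A_subset: "A \<subseteq> V \<times> V"
    and sym_A: "sym A"
    and irrefl_A: "irrefl A"
    and triangle_free: "\<And>u v w. (u, v) \<in> A \<Longrightarrow> (v, w) \<in> A \<Longrightarrow> (u, w) \<notin> A"
    and x_notin: "x \<notin> V"
begin

abbreviation "nbrs v \<equiv> A `` {v}"
abbreviation "deg v \<equiv> card (nbrs v)"

lemma adj_sym: "(u, v) \<in> A \<longleftrightarrow> (v, u) \<in> A"
  using sym_A unfolding sym_def by blast

lemma adj_neq: "(u, v) \<in> A \<Longrightarrow> u \<noteq> v"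
  using irrefl_A by (auto simp: irrefl_def)

lemma adj_irrefl: "(u, u) \<notin> A"
  using irrefl_A by (auto simp: irrefl_def)

lemma adj_in_V: "(u, v) \<in> A \<Longrightarrow> u \<in> V \<and> v \<in> V"
  using A_subset by auto

lemma finite_nbrs: "finite (nbrs v)"
  using A_subset finite_V by (auto intro: finite_subset)

lemma card_A: "card A = (\<Sum>v\<in>V. deg v)"
proof -
  have "A = (SIGMA v:V. nbrs v)" using adj_in_V by auto
  then show ?thesis using card_SigmaI[OF finite_V, of nbrs] finite_nbrs by simp
qed

text \<open>Double counting: \<open>u\<close> is a neighbour of exactly \<open>deg u\<close>
  vertices, so the term \<open>deg u\<close> occurs \<open>deg u\<close> times.\<close>

lemma sum_deg_nbrs: "(\<Sum>v\<in>V. \<Sum>u\<in>nbrs v. deg u) = (\<Sum>u\<in>V. (deg u)\<^sup>2)"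
proof -
  have "(\<Sum>v\<in>V. \<Sum>u\<in>nbrs v. deg u) = (\<Sum>v\<in>V. \<Sum>u | u \<in> V \<and> (u, v) \<in> A. deg u)"
    using adj_in_V adj_sym by (intro sum.cong) auto
  also have "\<dots> = (\<Sum>u\<in>V. \<Sum>v | v \<in> V \<and> (u, v) \<in> A. deg u)"
    by (rule sum.swap_restrict[OF finite_V finite_V])
  also have "\<dots> = (\<Sum>u\<in>V. \<Sum>v\<in>nbrs u. deg u)"
    using adj_in_V by (intro sum.cong) auto
  finally show ?thesis by (simp add: power2_eq_square)
qed

abbreviation "X \<equiv> link_extension x V A"

lemma three_graph_link_extension: "three_graph X"
proof -
  have "card {x, u, w} = 3" if "(u, w) \<in> A" for u w
    using adj_in_V[OF that] adj_neq[OF that] x_notin by (auto simp: card_insert_if)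
  then show ?thesis
    using finite_V adj_in_V unfolding three_graph_def link_extension_def by auto
qed

lemma apex_edge_iff: "{x, u, w} \<in> edges X \<longleftrightarrow> (u, w) \<in> A"
proof
  assume "{x, u, w} \<in> edges X"
  then obtain u' w' where A: "(u', w') \<in> A" and eq: "{x, u, w} = {x, u', w'}"
    using x_notin unfolding link_extension_def by auto
  have "u' \<noteq> x" "w' \<noteq> x" "u' \<noteq> w'" using A adj_in_V adj_neq x_notin by auto
  then have "u = u' \<and> w = w' \<or> u = w' \<and> w = u'"
    using eq by (auto simp: set_eq_iff)
  then show "(u, w) \<in> A" using A adj_sym by blast
qed (auto simp: link_extension_def)

text \<open>The three excluded conjunctions correspond to the three possible middle vertices of a
  path with two edges of \<open>A\<close> inside the triple.\<close>

lemma base_edge_iff: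
  assumes "v \<in> V" "u \<in> V" "w \<in> V"
  shows "{v, u, w} \<in> edges X \<longleftrightarrow> u \<noteq> v \<and> w \<noteq> v \<and> u \<noteq> w \<and>
    \<not> ((v, u) \<in> A \<and> (v, w) \<in> A) \<and> \<not> ((u, v) \<in> A \<and> (u, w) \<in> A) \<and> \<not> ((w, v) \<in> A \<and> (w, u) \<in> A)"
    (is "?L \<longleftrightarrow> ?R")
proof -
  let ?Q = "\<forall>p\<in>{v, u, w}. \<forall>q\<in>{v, u, w}. \<forall>r\<in>{v, u, w}. (p, q) \<in> A \<and> (p, r) \<in> A \<longrightarrow> q = r"
  have "x \<notin> {v, u, w}" using assms x_notin by auto
  then have "{v, u, w} \<notin> {{x, u, w} | u w. (u, w) \<in> A}" by auto
  then have "{v, u, w} \<in> edges X \<longleftrightarrow> {v, u, w} \<subseteq> V \<and> card {v, u, w} = 3 \<and> ?Q"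
    by (simp only: link_extension_def snd_conv Un_iff mem_Collect_eq simp_thms)
  then have mem: "{v, u, w} \<in> edges X \<longleftrightarrow> card {v, u, w} = 3 \<and> ?Q"
    using assms by (simp only: insert_subset empty_subsetI simp_thms)
  have "?L \<longleftrightarrow> u \<noteq> v \<and> w \<noteq> v \<and> u \<noteq> w \<and> ?Q"
  proof (cases "u \<noteq> v \<and> w \<noteq> v \<and> u \<noteq> w")
    case True
    then have "card {v, u, w} = 3" by (auto simp: card_insert_if)
    then show ?thesis using mem True by blast
  next
    case False
    then show ?thesis using three_graph_edge_distinct(1-3)[OF three_graph_link_extension, of v u w] by metis
  qed
  also have "\<dots> \<longleftrightarrow> ?R"
    using adj_irrefl[of u] adj_irrefl[of v] adj_irrefl[of w] by auto
  finally show ?thesis .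
qed

section \<open>Degrees in the link extension\<close>

lemma vdegree_apex: "2 * vdegree X x = (\<Sum>v\<in>V. deg v)"
  using card_link_pairs[OF three_graph_link_extension, of x] card_A by (simp add: apex_edge_iff)

lemma card_distinct_pairs:
  assumes "finite S"
  shows "card {(u, w). u \<in> S \<and> w \<in> S \<and> u \<noteq> w} = card S * (card S - 1)"
proof -
  have "{(u, w). u \<in> S \<and> w \<in> S \<and> u \<noteq> w} = (SIGMA u:S. S - {u})" by auto
  moreover have "card \<dots> = (\<Sum>u\<in>S. card (S - {u}))" using assms by (intro card_SigmaI) auto
  moreover have "\<dots> = (\<Sum>u\<in>S. card S - 1)" using assms by (intro sum.cong) auto
  ultimately show ?thesis by simp
qed

text \<open>Count ordered pairs completing \<open>v\<close> to an edge. \<open>L\<close> holds the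
  pairs containing \<open>x\<close>, and \<open>P\<close> all pairs of distinct vertices of
  \<open>V - {v}\<close>. From \<open>P\<close> one removes the pairs spanning a path with two
  edges: centred at \<open>v\<close> (\<open>B1\<close>), at the first entry (\<open>B2\<close>) or
  at the second (the converse of \<open>B2\<close>).\<close>

lemma vdegree_base:
  assumes v: "v \<in> V"
  shows "2 * int (vdegree X v) = (int (card V) - 1) * (int (card V) - 2) + 5 * int (deg v)
     - (int (deg v))\<^sup>2 - 2 * (\<Sum>u\<in>nbrs v. int (deg u))"
proof -
  define P where "P = {(u, w). u \<in> V - {v} \<and> w \<in> V - {v} \<and> u \<noteq> w}"
  define B1 where "B1 = {(u, w). u \<in> nbrs v \<and> w \<in> nbrs v \<and> u \<noteq> w}"
  define B2 where "B2 = (SIGMA u:nbrs v. nbrs u - {v})"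
  define L where "L = {x} \<times> nbrs v \<union> nbrs v \<times> {x}"
  have nb: "u \<in> V" "u \<noteq> v" "u \<noteq> x" "(u, v) \<in> A" if "(v, u) \<in> A" for u
    using adj_in_V[OF that] adj_neq[OF that] x_notin adj_sym that by auto
  have vx: "v \<noteq> x" using v x_notin by auto
  have fP: "finite P"
    by (rule finite_subset[of _ "V \<times> V"]) (auto simp: P_def finite_V)
  have B1P: "B1 \<subseteq> P" and B2P: "B2 \<subseteq> P" and B3P: "B2\<inverse> \<subseteq> P"
    using nb adj_in_V adj_irrefl by (auto simp: B1_def B2_def P_def)
  have fB: "finite B1" "finite B2" "finite (B2\<inverse>)"
    using B1P B2P B3P fP finite_subset by blast+
  \<comment> \<open>A pair in two of the three sets would form a triangle of \<open>A\<close> with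
    \<open>v\<close>.\<close>
  have "B1 \<inter> B2 = {}" "(B1 \<union> B2) \<inter> B2\<inverse> = {}"
    using triangle_free nb adj_sym by (auto simp: B1_def B2_def)
  then have cB: "card (B1 \<union> B2 \<union> B2\<inverse>) = card B1 + 2 * card B2"
    using fB by (simp add: card_Un_disjoint)
  have "{(u, w). {v, u, w} \<in> edges X} = L \<union> (P - (B1 \<union> B2 \<union> B2\<inverse>))" (is "?R = _")
  proof -
    have "{v, u, w} \<in> edges X \<longleftrightarrow> (u, w) \<in> L \<union> (P - (B1 \<union> B2 \<union> B2\<inverse>))" for u w
    proof -
      \<comment> \<open>In the last case \<open>u\<close> or \<open>w\<close> is not a vertex of
        \<open>X\<close> at all, so both sides are false.\<close>
      consider "u = x" | "u \<noteq> x" "w = x" | "u \<in> V" "w \<in> V" | "u \<noteq> x" "w \<noteq> x" "u \<notin> V \<or> w \<notin> V"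
        by blast
      then show ?thesis
      proof cases
        case 1
        have "{v, x, w} = {x, v, w}" by auto
        then have "{v, u, w} \<in> edges X \<longleftrightarrow> (v, w) \<in> A" using 1 apex_edge_iff by simp
        moreover have "(x, w) \<notin> P" "(v, x) \<notin> A" using x_notin nb by (auto simp: P_def)
        ultimately show ?thesis using 1 by (auto simp: L_def)
      next
        case 2
        have "{v, u, x} = {x, v, u}" by auto
        then have "{v, u, w} \<in> edges X \<longleftrightarrow> (v, u) \<in> A" using 2 apex_edge_iff by simp
        moreover have "(u, x) \<notin> P" using x_notin by (auto simp: P_def)
        ultimately show ?thesis using 2 by (auto simp: L_def)
      next
        case 3
        then have "(u, w) \<notin> L" using x_notin by (auto simp: L_def)
        moreover have "(u, w) \<in> P \<longleftrightarrow> u \<noteq> v \<and> w \<noteq> v \<and> u \<noteq> w" using 3 by (auto simp: P_def)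
        moreover have "(u, w) \<in> B1 \<longleftrightarrow> (v, u) \<in> A \<and> (v, w) \<in> A \<and> u \<noteq> w"
          by (auto simp: B1_def)
        moreover have "(u, w) \<in> B2 \<longleftrightarrow> (v, u) \<in> A \<and> (u, w) \<in> A \<and> w \<noteq> v"
          "(u, w) \<in> B2\<inverse> \<longleftrightarrow> (v, w) \<in> A \<and> (w, u) \<in> A \<and> u \<noteq> v"
          by (auto simp: B2_def)
        ultimately show ?thesis
          using base_edge_iff[OF v 3] adj_sym[of v u] adj_sym[of v w] by blast
      next
        case 4
        then have "{v, u, w} \<notin> edges X"
          using three_graph_edge_distinct(5,6)[OF three_graph_link_extension, of v u w]
          by (auto simp: link_extension_def)
        moreover have "(u, w) \<notin> L" "(u, w) \<notin> P" using 4 by (auto simp: L_def P_def)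
        ultimately show ?thesis by blast
      qed
    qed
    then show ?thesis by auto
  qed
  moreover have "L \<inter> P = {}" using x_notin by (auto simp: L_def P_def)
  moreover have "finite L" by (simp add: L_def finite_nbrs)
  ultimately have "card ?R = card L + card (P - (B1 \<union> B2 \<union> B2\<inverse>))"
    using fP by (simp add: card_Un_disjoint Diff_Int_distrib)
  also have "int \<dots> = int (card L) + int (card P) - int (card (B1 \<union> B2 \<union> B2\<inverse>))"
  proof -
    have "B1 \<union> B2 \<union> B2\<inverse> \<subseteq> P" using B1P B2P B3P by blast
    then have "card (P - (B1 \<union> B2 \<union> B2\<inverse>)) = card P - card (B1 \<union> B2 \<union> B2\<inverse>)"
      "card (B1 \<union> B2 \<union> B2\<inverse>) \<le> card P"
      using fP fB by (auto intro: card_Diff_subset card_mono)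
    then show ?thesis by linarith
  qed
  finally have main: "2 * int (vdegree X v) =
      int (card L) + int (card P) - int (card B1) - 2 * int (card B2)"
    using cB card_link_pairs[OF three_graph_link_extension, of v] by simp
  have "{x} \<times> nbrs v \<inter> nbrs v \<times> {x} = {}" using nb by auto
  then have cL: "card L = 2 * deg v"
    unfolding L_def using finite_nbrs by (simp add: card_Un_disjoint card_cartesian_product)
  have cV: "card V \<ge> 1" using v finite_V by (metis One_nat_def Suc_leI card_gt_0_iff empty_iff)
  \<comment> \<open>Truncated subtraction does no harm here, since both sides vanish at
    \<open>k = 0\<close>.\<close>
  have times_pred: "int (k * (k - 1)) = int k * (int k - 1)" for k by (cases k) (auto simp: algebra_simps)
  have "int (card (V - {v})) = int (card V) - 1" using v finite_V cV by (simp add: of_nat_diff)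
  then have cP: "int (card P) = (int (card V) - 1) * (int (card V) - 2)"
    unfolding P_def using card_distinct_pairs[of "V - {v}"] finite_V times_pred[of "card (V - {v})"]
    by (simp del: of_nat_mult of_nat_diff card_Diff_singleton card_Diff_insert)
  have cB1: "int (card B1) = int (deg v) * (int (deg v) - 1)"
    unfolding B1_def using card_distinct_pairs[OF finite_nbrs, of v] times_pred by simp
  have "card B2 = (\<Sum>u\<in>nbrs v. card (nbrs u - {v}))"
    unfolding B2_def using finite_nbrs by (intro card_SigmaI) auto
  also have "int \<dots> = (\<Sum>u\<in>nbrs v. int (deg u) - 1)"
  proof -
    have "int (card (nbrs u - {v})) = int (deg u) - 1" if "u \<in> nbrs v" for u
    proof -
      \<comment> \<open>As \<open>v\<close> is itself a neighbour of \<open>u\<close>, deleting it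
        lowers the count by exactly one.\<close>
      have "v \<in> nbrs u" using that adj_sym by auto
      moreover have "deg u \<ge> 1" using calculation finite_nbrs by (metis One_nat_def Suc_leI card_gt_0_iff empty_iff)
      ultimately show ?thesis using finite_nbrs by (simp add: of_nat_diff)
    qed
    then show ?thesis by simp
  qed
  finally have cB2: "int (card B2) = (\<Sum>u\<in>nbrs v. int (deg u)) - int (deg v)"
    by (simp add: sum_subtractf)
  show ?thesis
    unfolding main cP cB1 cB2 cL by (simp add: algebra_simps power2_eq_square)
qed

text \<open>The coefficient 3 combines the square in \<open>vdegree_base\<close> with twice the sum
  over neighbours, which by \<open>sum_deg_nbrs\<close> is again a sum of squares.\<close>

lemma sum_vdegree_base:
  "2 * (\<Sum>v\<in>V. int (vdegree X v)) = int (card V) * (int (card V) - 1) * (int (card V) - 2)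
     + 5 * (\<Sum>v\<in>V. int (deg v)) - 3 * (\<Sum>v\<in>V. (int (deg v))\<^sup>2)"
proof -
  have "(\<Sum>v\<in>V. \<Sum>u\<in>nbrs v. int (deg u)) = (\<Sum>u\<in>V. (int (deg u))\<^sup>2)"
    using arg_cong[OF sum_deg_nbrs, of int] by simp
  moreover have "2 * (\<Sum>v\<in>V. int (vdegree X v)) = (\<Sum>v\<in>V. 2 * int (vdegree X v))"
    by (simp add: sum_distrib_left)
  moreover have "\<dots> = (\<Sum>v\<in>V. (int (card V) - 1) * (int (card V) - 2) + 5 * int (deg v)
     - (int (deg v))\<^sup>2 - 2 * (\<Sum>u\<in>nbrs v. int (deg u)))"
    using vdegree_base by (intro sum.cong) auto
  ultimately show ?thesis
    by (simp add: sum.distrib sum_subtractf flip: sum_distrib_left)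
qed

text \<open>If \<open>x\<close> is the vertex common to the three edges of a copy, the other three
  vertices form a triangle of \<open>A\<close>. Otherwise the edge of the copy avoiding
  \<open>x\<close> contains two edges of \<open>A\<close>.\<close>

lemma link_extension_no_covering: "\<not> has_covering K4_minus X"
proof
  assume "has_covering K4_minus X"
  moreover have "x \<in> verts X" by (simp add: link_extension_def)
  ultimately obtain a b c d where x: "x \<in> {a, b, c, d}"
    and e: "{a, b, c} \<in> edges X" "{a, b, d} \<in> edges X" "{a, c, d} \<in> edges X"
    unfolding has_covering_K4_minus_iff[OF three_graph_link_extension] by blast
  \<comment> \<open>Here \<open>p\<close> is the vertex common to the three edges, and
    \<open>x\<close> is one of the other vertices of the copy.\<close>
  have no: False
    if "{x, p, q} \<in> edges X" "{x, p, r} \<in> edges X" "{p, q, r} \<in> edges X" for p q r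
  proof -
    have A: "(p, q) \<in> A" "(p, r) \<in> A" using that apex_edge_iff by auto
    then have "p \<in> V" "q \<in> V" "r \<in> V" using adj_in_V by auto
    then show False using that(3) A base_edge_iff by blast
  qed
  have "x \<noteq> a"
  proof
    assume "x = a"
    then have "(b, c) \<in> A" "(b, d) \<in> A" "(c, d) \<in> A" using e apex_edge_iff by auto
    then show False using triangle_free by blast
  qed
  then consider "x = b" | "x = c" | "x = d" using x by blast
  then show False
  proof cases
    case 1 then show False using no[of a c d] e by (simp add: insert_commute)
  next
    case 2 then show False using no[of a b d] e by (simp add: insert_commute)
  next
    case 3 then show False using no[of a b c] e by (simp add: insert_commute)
  qed
qed

end

section \<open>The covering threshold\<close>

lemma min_vdegree_le:
  assumes "three_graph G" "v \<in> verts G"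
  shows "min_vdegree G \<le> vdegree G v"
  using assms unfolding min_vdegree_def three_graph_def by simp

lemma le_min_vdegree:
  assumes "three_graph G" "verts G \<noteq> {}" "\<And>v. v \<in> verts G \<Longrightarrow> k \<le> vdegree G v"
  shows "k \<le> min_vdegree G"
  using assms unfolding min_vdegree_def three_graph_def by simp

text \<open>The crude bound by the number of vertex subsets suffices, as it only serves to make
  \<open>Max\<close> meaningful.\<close>

lemma finite_min_vdegrees:
  assumes "n \<ge> 1"
  shows "finite {min_vdegree G | G :: nat hgraph.
    three_graph G \<and> card (verts G) = n \<and> \<not> has_covering F G}" (is "finite ?S")
proof -
  have "min_vdegree G \<le> 2 ^ n" if G: "three_graph G" "card (verts G) = n" for G :: "nat hgraph"
  proof -
    have "verts G \<noteq> {}" using G(2) assms by auto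
    then obtain v where "v \<in> verts G" by blast
    then have "min_vdegree G \<le> vdegree G v" using G(1) by (intro min_vdegree_le)
    also have "\<dots> \<le> card (Pow (verts G))"
      unfolding vdegree_def using G(1) by (intro card_mono) (auto simp: three_graph_def)
    also have "\<dots> = 2 ^ n" using G by (simp add: card_Pow three_graph_def)
    finally show ?thesis .
  qed
  then have "?S \<subseteq> {..2 ^ n}" by auto
  then show ?thesis by (rule finite_subset) simp
qed

lemma cov_threshold_ge:
  fixes G :: "nat hgraph"
  assumes "n \<ge> 1" "three_graph G" "card (verts G) = n" "\<not> has_covering F G"
  shows "min_vdegree G \<le> cov_threshold n F"
  unfolding cov_threshold_def using assms by (intro Max_ge[OF finite_min_vdegrees]) blast+

text \<open>The edgeless 3-graph has no covering, so the maximum is over a nonempty finite set and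
  is a member of it.\<close>

lemma cov_threshold_K4_minus_attained:
  assumes "n \<ge> 1"
  obtains G :: "nat hgraph" where "three_graph G" "card (verts G) = n"
    "\<not> has_covering K4_minus G" "cov_threshold n K4_minus = min_vdegree G"
proof -
  let ?S = "{min_vdegree G | G :: nat hgraph.
    three_graph G \<and> card (verts G) = n \<and> \<not> has_covering K4_minus G}"
  let ?E = "({..<n}, {}) :: nat hgraph"
  have E: "three_graph ?E" by (simp add: three_graph_def)
  have "0 \<in> verts ?E" using assms by simp
  then have "\<not> has_covering K4_minus ?E" unfolding has_covering_K4_minus_iff[OF E] by auto
  then have "min_vdegree ?E \<in> ?S" using E by force
  then have "?S \<noteq> {}" by blast
  then have "cov_threshold n K4_minus \<in> ?S"
    unfolding cov_threshold_def by (rule Max_in[OF finite_min_vdegrees[OF assms]])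
  then show thesis using that by blast
qed

section \<open>The quadratic equation of \<open>d_star\<close> and the upper bound\<close>

text \<open>\<open>d_star n\<close> is the larger root of
  \<open>3 * y^2 + (n - 6) * y - (n - 2) * (n - 3)\<close>, whose discriminant is the radicand. With
  \<open>N = n - 1\<close> the equation reads
  \<open>N * y = (N - 1) * (N - 2) + 5 * y - 3 * y^2\<close>, the equality of the two degree
  bounds.\<close>

lemma d_star_quadratic:
  assumes "n \<ge> 3"
  shows "3 * (d_star n)\<^sup>2 + d_star n * (real n - 6) = (real n - 2) * (real n - 3)"
    and "1 \<le> d_star n"
proof -
  define s where "s = sqrt (13 * (real n)\<^sup>2 - 72 * real n + 108)"
  \<comment> \<open>This form shows at once that the radicand is nonnegative and that its root is at
    least \<open>n\<close>.\<close>
  have eq: "13 * (real n)\<^sup>2 - 72 * real n + 108 = (real n)\<^sup>2 + 12 * (real n - 3)\<^sup>2"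
    by (simp add: power2_eq_square algebra_simps)
  have "s\<^sup>2 = (real n)\<^sup>2 + 12 * (real n - 3)\<^sup>2"
    unfolding s_def eq by (intro real_sqrt_pow2) simp
  then have "s\<^sup>2 = 13 * (real n)\<^sup>2 - 72 * real n + 108"
    unfolding eq .
  then have s2: "s * s = 13 * (real n * real n) - 72 * real n + 108"
    by (simp add: power2_eq_square)
  have z: "d_star n = (s - real n + 6) / 6" unfolding d_star_def s_def by simp
  have "real n \<le> s" unfolding s_def eq by (rule real_le_rsqrt) simp
  then show "1 \<le> d_star n" unfolding z by simp
  have "3 * (d_star n)\<^sup>2 + d_star n * (real n - 6) = (s * s - (real n - 6)\<^sup>2) / 12"
    unfolding z by (simp add: power2_eq_square field_simps)
  then show "3 * (d_star n)\<^sup>2 + d_star n * (real n - 6) = (real n - 2) * (real n - 3)"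
    unfolding s2 by (simp add: power2_eq_square field_simps)
qed

text \<open>With \<open>A\<close> the link of an uncovered vertex, \<open>G\<close> is contained in
  \<open>X\<close>, so its minimum degree is at most the degree of \<open>x\<close> in
  \<open>X\<close> and at most the average degree in \<open>X\<close> over \<open>V\<close>.\<close>

lemma min_vdegree_le_d_star:
  fixes G :: "'a hgraph"
  assumes G: "three_graph G" and n: "card (verts G) = n" "n \<ge> 3"
    and cov: "\<not> has_covering K4_minus G"
  shows "real (min_vdegree G) \<le> (real n - 1) / 2 * d_star n"
proof -
  obtain x where x: "x \<in> verts G" and no_copy: "\<And>a b c d. x \<in> {a, b, c, d} \<Longrightarrow>
      {a, b, c} \<in> edges G \<Longrightarrow> {a, b, d} \<in> edges G \<Longrightarrow> {a, c, d} \<notin> edges G"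
    using cov unfolding has_covering_K4_minus_iff[OF G] by blast
  define V where "V = verts G - {x}"
  define A where "A = {(u, w). {x, u, w} \<in> edges G}"
  have finG: "finite (verts G)" using G unfolding three_graph_def by simp
  note dist = three_graph_edge_distinct[OF G]
  interpret triangle_free_graph V A x
  proof
    show "finite V" using finG by (simp add: V_def)
    show "A \<subseteq> V \<times> V"
    proof clarify
      fix u w assume "(u, w) \<in> A"
      then have e: "{x, u, w} \<in> edges G" by (simp add: A_def)
      show "u \<in> V \<and> w \<in> V" using dist[OF e] by (simp add: V_def)
    qed
    show "sym A" by (auto simp: A_def sym_def insert_commute)
    show "irrefl A" using dist(3)[of x u u for u] by (auto simp: A_def irrefl_def)
    show "(u, w) \<notin> A" if "(u, v) \<in> A" "(v, w) \<in> A" for u v w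
    proof -
      have "{x, v, u} \<in> edges G" "{x, v, w} \<in> edges G"
        using that by (simp_all add: A_def insert_commute)
      then have "{x, u, w} \<notin> edges G" using no_copy by blast
      then show ?thesis by (simp add: A_def)
    qed
    show "x \<notin> V" by (simp add: V_def)
  qed
  have sub: "e \<in> edges X" if e: "e \<in> edges G" for e
  proof (cases "x \<in> e")
    case True
    have "card e = 3" using e G unfolding three_graph_def by simp
    then have "card (e - {x}) = 2" using True by simp
    then obtain u w where "e - {x} = {u, w}" by (auto simp: card_2_iff)
    then have "e = {x, u, w}" using True by auto
    then show ?thesis using e apex_edge_iff by (simp add: A_def)
  next
    case False
    have c: "card e = 3" and eG: "e \<subseteq> verts G" using e G unfolding three_graph_def by simp_all
    have "q = r" if pqr: "p \<in> e" "q \<in> e" "r \<in> e" "(p, q) \<in> A" "(p, r) \<in> A" for p q r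
    \<comment> \<open>Two edges of \<open>A\<close> at \<open>p\<close> inside \<open>e\<close>
      would give a copy on \<open>p, x, q, r\<close> in which \<open>p\<close> lies in all three
      edges.\<close>
    proof (rule ccontr)
      assume "q \<noteq> r"
      moreover have "p \<noteq> q" "p \<noteq> r" using pqr adj_neq by auto
      ultimately have "card {p, q, r} = card e" using c by simp
      moreover have "finite e" using c by (metis card.infinite zero_neq_numeral)
      moreover have "{p, q, r} \<subseteq> e" using pqr by simp
      ultimately have "{p, q, r} = e" by (intro card_subset_eq)
      moreover have "{p, x, q} \<in> edges G" "{p, x, r} \<in> edges G"
        using pqr by (simp_all add: A_def insert_commute)
      ultimately show False using no_copy[of p x q r] e by simp
    qed
    moreover have "e \<subseteq> V" using eG False by (auto simp: V_def)
    ultimately show ?thesis using c by (auto simp: link_extension_def)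
  qed
  define t where "t = real (min_vdegree G)"
  define N where "N = real (card V)"
  define S where "S = (\<Sum>v\<in>V. real (deg v))"
  have deg_le: "min_vdegree G \<le> vdegree X v" if "v \<in> verts G" for v
    using min_vdegree_le[OF G that] vdegree_mono[OF three_graph_link_extension, of G v] sub
    by (meson order_trans subsetI)
  have N: "N = real n - 1" using n x finG by (simp add: N_def V_def of_nat_diff)
  then have "N \<ge> 2" using n by simp
  have "2 * min_vdegree G \<le> (\<Sum>v\<in>V. deg v)"
    using deg_le[OF x] vdegree_apex by simp
  then have "real (2 * min_vdegree G) \<le> real (\<Sum>v\<in>V. deg v)" by (rule of_nat_mono)
  then have t1: "2 * t \<le> S" by (simp add: t_def S_def)
  have "(\<Sum>v\<in>V. t) \<le> (\<Sum>v\<in>V. real (vdegree X v))"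
    unfolding t_def using deg_le by (intro sum_mono) (auto simp: V_def)
  moreover have "2 * (\<Sum>v\<in>V. real (vdegree X v)) =
      N * (N - 1) * (N - 2) + 5 * S - 3 * (\<Sum>v\<in>V. (real (deg v))\<^sup>2)"
    unfolding N_def S_def using arg_cong[OF sum_vdegree_base, of real_of_int] by simp
  ultimately have t2: "2 * (N * t) \<le> N * (N - 1) * (N - 2) + 5 * S - 3 * (\<Sum>v\<in>V. (real (deg v))\<^sup>2)"
    by (simp add: N_def)
  define D where "D = S / N"
  have S: "S = N * D" using \<open>N \<ge> 2\<close> by (simp add: D_def)
  \<comment> \<open>The variance of the degrees is nonnegative, which bounds their sum of squares
    below by \<open>N * D^2\<close>.\<close>
  have "0 \<le> (\<Sum>v\<in>V. (real (deg v) - D)\<^sup>2)" by (intro sum_nonneg) simp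
  also have "\<dots> = (\<Sum>v\<in>V. (real (deg v))\<^sup>2) + N * D\<^sup>2 - 2 * (S * D)"
    by (simp add: power2_diff sum.distrib sum_subtractf S_def N_def mult.assoc
        flip: sum_distrib_left sum_distrib_right)
  finally have "N * D\<^sup>2 \<le> (\<Sum>v\<in>V. (real (deg v))\<^sup>2)" by (simp add: S power2_eq_square mult_ac)
  with t2 have "2 * (N * t) \<le> N * (N - 1) * (N - 2) + 5 * S - 3 * (N * D\<^sup>2)" by linarith
  then have "N * (2 * t) \<le> N * ((N - 1) * (N - 2) + 5 * D - 3 * D\<^sup>2)"
    unfolding S by (simp add: algebra_simps)
  then have t2': "2 * t \<le> (N - 1) * (N - 2) + 5 * D - 3 * D\<^sup>2" using \<open>N \<ge> 2\<close> by simp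
  let ?z = "d_star n"
  have z: "3 * ?z\<^sup>2 + ?z * (N - 5) = (N - 1) * (N - 2)" "1 \<le> ?z"
    using d_star_quadratic[OF n(2)] by (simp_all add: N)
  have "2 * t \<le> N * ?z"
  proof (cases "D \<le> ?z")
    case True
    then have "N * D \<le> N * ?z" using \<open>N \<ge> 2\<close> by simp
    then show ?thesis using t1 S by linarith
  next
    case False
    \<comment> \<open>The map \<open>y \<mapsto> 5 * y - 3 * y^2\<close> does not increase from
      \<open>?z\<close> to \<open>D\<close>, because \<open>D + ?z\<close> exceeds 2. Hence the
      averaged bound at \<open>D\<close> is at most its value at \<open>?z\<close>, which is
      \<open>N * ?z\<close>.\<close>
    then have "0 \<le> (D - ?z) * (3 * (D + ?z) - 5)" using z(2) by (intro mult_nonneg_nonneg) auto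
    then show ?thesis using t2' z(1) by (simp add: algebra_simps power2_eq_square)
  qed
  then show ?thesis by (simp add: t_def N)
qed

section \<open>A regular bipartite link and the lower bound\<close>

text \<open>On \<open>m\<close> consecutive integers the map
  \<open>w \<mapsto> (u + w) mod m\<close> is a bijection onto the residues.\<close>

lemma card_interval_mod_less:
  fixes d m :: nat
  assumes "d \<le> m"
  shows "card {w \<in> {a..<a + m}. (u + w) mod m < d} = d"
proof -
  let ?f = "\<lambda>w. (u + w) mod m"
  have inj: "inj_on ?f {a..<a + m}"
  proof (rule linorder_inj_onI')
    fix w w' assume w: "w \<in> {a..<a + m}" "w' \<in> {a..<a + m}" "w < w'"
    show "?f w \<noteq> ?f w'"
    proof
      assume "?f w = ?f w'"
      then have "m dvd (u + w') - (u + w)" using w by (intro mod_eq_dvd_iff_nat[THEN iffD1]) auto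
      then have "m \<le> w' - w" using w by (auto dest: dvd_imp_le)
      then show False using w by auto
    qed
  qed
  have "?f ` {a..<a + m} = {..<m}"
  proof (rule card_subset_eq)
    show "?f ` {a..<a + m} \<subseteq> {..<m}" by auto
    show "card (?f ` {a..<a + m}) = card {..<m}" using card_image[OF inj] by simp
  qed simp
  moreover have "?f ` {w \<in> {a..<a + m}. ?f w < d} = ?f ` {a..<a + m} \<inter> {..<d}" by blast
  ultimately have "?f ` {w \<in> {a..<a + m}. ?f w < d} = {..<d}" using assms by auto
  moreover have "inj_on ?f {w \<in> {a..<a + m}. ?f w < d}" using inj by (rule inj_on_subset) auto
  ultimately show ?thesis by (metis card_image card_lessThan)
qed

text \<open>A \<open>d\<close>-regular bipartite graph (for \<open>d \<le> m\<close>) with sides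
  \<open>{..<m}\<close> and \<open>{m..<2 * m}\<close>. Using the sum \<open>u + w\<close> rather
  than a difference makes the relation symmetric.\<close>

definition circulant_adj :: "nat \<Rightarrow> nat \<Rightarrow> nat rel" where
  "circulant_adj m d = {(u, w). (u + w) mod m < d \<and>
     (u < m \<and> w \<in> {m..<m + m} \<or> u \<in> {m..<m + m} \<and> w < m)}"

lemma card_circulant_nbrs:
  assumes "d \<le> m"
  shows "card (circulant_adj m d `` {u}) = (if u < 2 * m then d else 0)"
proof -
  consider "u < m" | "m \<le> u" "u < 2 * m" | "2 * m \<le> u" by linarith
  then show ?thesis
  proof cases
    case 1
    then have "circulant_adj m d `` {u} = {w \<in> {m..<m + m}. (u + w) mod m < d}"
      by (auto simp: circulant_adj_def)
    then show ?thesis using 1 card_interval_mod_less[OF assms, of m u] by simp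
  next
    case 2
    then have "circulant_adj m d `` {u} = {w \<in> {0..<0 + m}. (u + w) mod m < d}"
      by (auto simp: circulant_adj_def)
    then show ?thesis using 2 card_interval_mod_less[OF assms, of 0 u] by simp
  next
    case 3
    then have "circulant_adj m d `` {u} = {}" by (auto simp: circulant_adj_def)
    then show ?thesis using 3 by simp
  qed
qed

text \<open>The apex is the number \<open>N\<close>, and the base vertices from \<open>2 * m\<close>
  on are isolated in the link. The apex has degree \<open>m * d\<close>, and \<open>quad\<close> is
  exactly what gives the non-isolated base vertices degree at least
  \<open>N * d / 2\<close>.\<close>

lemma cov_threshold_K4_minus_ge:
  assumes m: "2 * m \<le> N" and N: "2 \<le> N" and d: "d \<le> m"
    and quad: "3 * (int d)\<^sup>2 + int d * (int N - 5) \<le> (int N - 1) * (int N - 2)"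
  shows "m * d \<le> cov_threshold (N + 1) K4_minus"
proof -
  define A where "A = circulant_adj m d"
  interpret triangle_free_graph "{..<N}" A N
  proof
    show "A \<subseteq> {..<N} \<times> {..<N}" using m by (auto simp: A_def circulant_adj_def)
    show "sym A" by (auto simp: A_def circulant_adj_def sym_def add.commute)
    show "irrefl A" by (auto simp: A_def circulant_adj_def irrefl_def)
    show "(u, w) \<notin> A" if "(u, v) \<in> A" "(v, w) \<in> A" for u v w
      using that by (auto simp: A_def circulant_adj_def)
  qed auto
  have deg: "deg u = (if u < 2 * m then d else 0)" for u
    unfolding A_def by (rule card_circulant_nbrs[OF d])
  have "2 * vdegree X N = (\<Sum>v<N. if v < 2 * m then d else 0)"
    unfolding vdegree_apex by (simp add: deg)
  also have "\<dots> = (\<Sum>v<2 * m. d)"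
    using m by (intro sum.mono_neutral_cong_right) auto
  finally have apex: "vdegree X N = m * d" by simp
  have dm: "int d * (2 * int m) \<le> int d * int N" using m by (intro mult_left_mono) auto
  have base: "m * d \<le> vdegree X v" if v: "v < N" for v
  proof (cases "v < 2 * m")
    case True
    have "int (deg u) = int d" if "u \<in> nbrs v" for u
    proof -
      have "u < 2 * m" using that by (auto simp: A_def circulant_adj_def)
      then show ?thesis by (simp add: deg)
    qed
    then have "(\<Sum>u\<in>nbrs v. int (deg u)) = int (deg v) * int d" by simp
    then have "(\<Sum>u\<in>nbrs v. int (deg u)) = int d * int d" using True by (simp add: deg)
    then have "2 * int (vdegree X v) = (int N - 1) * (int N - 2) + 5 * int d - 3 * (int d)\<^sup>2"
      using vdegree_base[of v] v True by (simp add: deg power2_eq_square)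
    then have "2 * int (m * d) \<le> 2 * int (vdegree X v)"
      using quad dm by (simp add: algebra_simps power2_eq_square)
    then show ?thesis by linarith
  next
    case False
    then have "nbrs v = {}" by (auto simp: A_def circulant_adj_def)
    then have deg_v: "2 * int (vdegree X v) = (int N - 1) * (int N - 2)"
      using vdegree_base[of v] v by simp
    show ?thesis
    proof (cases "m = 0")
      case False
      \<comment> \<open>An isolated base vertex forces \<open>2 * m < N\<close>. Then
        \<open>2 * m * d\<close> is at most \<open>2 * m * m\<close>, hence at most
        \<open>(N - 1) * m\<close>, and \<open>m \<le> N - 2\<close>.\<close>
      then have "N \<ge> 3" "2 * int m \<le> int N - 1" using \<open>\<not> v < 2 * m\<close> v by auto
      have "2 * int (m * d) \<le> 2 * int m * int m" using d by (simp add: mult_left_mono)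
      also have "\<dots> \<le> (int N - 1) * int m"
        using \<open>2 * int m \<le> int N - 1\<close> by (intro mult_right_mono) auto
      also have "\<dots> \<le> (int N - 1) * (int N - 2)"
        using \<open>2 * int m \<le> int N - 1\<close> \<open>N \<ge> 3\<close> by (intro mult_left_mono) auto
      finally show ?thesis using deg_v by linarith
    qed simp
  qed
  have verts: "verts X = insert N {..<N}" by (simp add: link_extension_def)
  have "m * d \<le> min_vdegree X"
    using apex base by (intro le_min_vdegree[OF three_graph_link_extension]) (auto simp: verts)
  also have "\<dots> \<le> cov_threshold (N + 1) K4_minus"
    using link_extension_no_covering
    by (intro cov_threshold_ge[OF _ three_graph_link_extension]) (auto simp: verts)
  finally show ?thesis .
qed

text \<open>The quadratic is strictly increasing on the range in question, so
  \<open>d_star n\<close> cannot exceed a positive \<open>y\<close> at which it is nonnegative. This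
  serves to check that \<open>d_star n\<close> does not exceed the size of a side of the bipartite
  graph.\<close>

lemma d_star_le:
  assumes n: "n \<ge> 3" and y: "0 < y" "(real n - 2) * (real n - 3) \<le> 3 * y\<^sup>2 + y * (real n - 6)"
  shows "d_star n \<le> y"
proof (rule ccontr)
  assume "\<not> d_star n \<le> y"
  moreover have "3 \<le> real n" using n by simp
  ultimately have "0 < (d_star n - y) * (3 * (d_star n + y) + real n - 6)"
    using y(1) d_star_quadratic(2)[OF n] by (intro mult_pos_pos) argo+
  then show False
    using y(2) d_star_quadratic(1)[OF n] by (simp add: algebra_simps power2_eq_square)
qed

lemma cov_threshold_K4_minus_ge_floor:
  assumes n: "n \<ge> 3" and le: "d_star n \<le> real ((n - 1) div 2)"
  shows "real ((n - 1) div 2) * of_int \<lfloor>d_star n\<rfloor> \<le> real (cov_threshold n K4_minus)"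
proof -
  let ?z = "d_star n"
  note z = d_star_quadratic[OF n]
  define d where "d = nat \<lfloor>?z\<rfloor>"
  have d: "real d = of_int \<lfloor>?z\<rfloor>" using z(2) by (simp add: d_def)
  then have dz: "real d \<le> ?z" by simp
  have "3 \<le> real n" using n by simp
  \<comment> \<open>The product is the difference of the values of
    \<open>3 * y^2 + y * (n - 6)\<close> at \<open>?z\<close> and at \<open>d\<close>; its second
    factor is nonnegative as \<open>?z \<ge> 1\<close> and \<open>n \<ge> 3\<close>.\<close>
  then have "0 \<le> (?z - real d) * (3 * (?z + real d) + real n - 6)"
    using dz z(2) of_nat_0_le_iff[of d, where 'a = real] by (intro mult_nonneg_nonneg) argo+
  then have "3 * (real d)\<^sup>2 + real d * (real n - 6) \<le> (real n - 2) * (real n - 3)"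
    using z(1) by (simp add: algebra_simps power2_eq_square)
  then have "real_of_int (3 * (int d)\<^sup>2 + int d * (int n - 6)) \<le> real_of_int ((int n - 2) * (int n - 3))"
    by simp
  then have "3 * (int d)\<^sup>2 + int d * (int n - 6) \<le> (int n - 2) * (int n - 3)"
    by (simp only: of_int_le_iff)
  moreover have "int (n - 1) = int n - 1" using n by simp
  ultimately have "3 * (int d)\<^sup>2 + int d * (int (n - 1) - 5) \<le> (int (n - 1) - 1) * (int (n - 1) - 2)"
    by (simp add: algebra_simps)
  moreover have "d \<le> (n - 1) div 2" using dz le by linarith
  ultimately have "(n - 1) div 2 * d \<le> cov_threshold (n - 1 + 1) K4_minus"
    using n by (intro cov_threshold_K4_minus_ge) auto
  then have "real ((n - 1) div 2 * d) \<le> real (cov_threshold n K4_minus)"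
    using n by (intro of_nat_mono) simp
  then show ?thesis by (simp add: d)
qed

lemma cov_threshold_K4_minus_le:
  assumes n: "n \<ge> 3"
  shows "real (cov_threshold n K4_minus) \<le> (real n - 1) / 2 * d_star n"
proof -
  have "n \<ge> 1" using n by simp
  then obtain G :: "nat hgraph" where "three_graph G" "card (verts G) = n"
    "\<not> has_covering K4_minus G" "cov_threshold n K4_minus = min_vdegree G"
    by (rule cov_threshold_K4_minus_attained)
  then show ?thesis using min_vdegree_le_d_star[of G n] n by simp
qed

section \<open>The covering density\<close>

text \<open>Pulling \<open>n\<close> out of the root leaves a continuous function of
  \<open>1 / n\<close>, evaluated at 0 in the limit.\<close>

lemma d_star_over_n: "(\<lambda>n. d_star n / real n) \<longlonglongrightarrow> (sqrt 13 - 1) / 6"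
proof (rule Lim_transform_eventually)
  have "(\<lambda>n. 1 / real n) \<longlonglongrightarrow> 0" by (rule lim_1_over_n)
  then have "(\<lambda>n. 1 / 6 * (sqrt (13 - 72 * (1 / real n) + 108 * (1 / real n)\<^sup>2) - 1 + 6 * (1 / real n)))
      \<longlonglongrightarrow> 1 / 6 * (sqrt (13 - 72 * 0 + 108 * 0\<^sup>2) - 1 + 6 * 0)"
    by (intro tendsto_intros)
  then show "(\<lambda>n. 1 / 6 * (sqrt (13 - 72 * (1 / real n) + 108 * (1 / real n)\<^sup>2) - 1 + 6 * (1 / real n)))
      \<longlonglongrightarrow> (sqrt 13 - 1) / 6" by simp
  show "\<forall>\<^sub>F n in sequentially.
      1 / 6 * (sqrt (13 - 72 * (1 / real n) + 108 * (1 / real n)\<^sup>2) - 1 + 6 * (1 / real n)) = d_star n / real n"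
    using eventually_gt_at_top[of 0]
  proof eventually_elim
    case (elim n)
    have "13 * (real n)\<^sup>2 - 72 * real n + 108 =
        (13 - 72 * (1 / real n) + 108 * (1 / real n)\<^sup>2) * (real n)\<^sup>2"
      using elim by (simp add: field_simps power2_eq_square)
    then have "sqrt (13 * (real n)\<^sup>2 - 72 * real n + 108) =
        sqrt (13 - 72 * (1 / real n) + 108 * (1 / real n)\<^sup>2) * real n"
      using elim by (simp add: real_sqrt_mult)
    then show ?case unfolding d_star_def using elim by (simp add: field_simps)
  qed
qed

lemma real_choose_two: "real (k choose 2) = real k * (real k - 1) / 2"
  by (induction k) (simp_all add: numeral_2_eq_2 field_simps)

text \<open>The floor costs less than 1 and an isolated base vertex replaces
  \<open>(n - 1) / 2\<close> by \<open>(n - 2) / 2\<close>; both losses vanish in the limit, so all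
  parities of \<open>n\<close> can be treated together.\<close>

lemma cov_ratio_K4_minus_tendsto: "cov_ratio K4_minus \<longlonglongrightarrow> (sqrt 13 - 1) / 6"
proof (rule tendsto_sandwich)
  have ratio: "cov_ratio K4_minus n =
      real (cov_threshold n K4_minus) * 2 / ((real n - 1) * (real n - 2))" if "n \<ge> 1" for n
    using that unfolding cov_ratio_def real_choose_two by (simp add: of_nat_diff)
  show "\<forall>\<^sub>F n in sequentially. cov_ratio K4_minus n \<le> d_star n / (real n - 2)"
    using eventually_ge_at_top[of 3]
  proof eventually_elim
    case (elim n)
    then have "n \<ge> 1" by simp
    have "cov_ratio K4_minus n \<le> (real n - 1) / 2 * d_star n * 2 / ((real n - 1) * (real n - 2))"
      unfolding ratio[OF \<open>n \<ge> 1\<close>] using elim cov_threshold_K4_minus_le[OF elim]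
      by (intro divide_right_mono mult_right_mono) simp_all
    also have "\<dots> = d_star n / (real n - 2)" using elim by simp
    finally show ?case .
  qed
  show "\<forall>\<^sub>F n in sequentially. (d_star n - 1) / (real n - 1) \<le> cov_ratio K4_minus n"
    using eventually_ge_at_top[of 6]
  proof eventually_elim
    case (elim n)
    then have "n \<ge> 1" by simp
    have "real n - 2 \<le> 2 * real ((n - 1) div 2)" using elim by linarith
    then have m: "(real n - 2) / 2 \<le> real ((n - 1) div 2)" by simp
    \<comment> \<open>At \<open>y = (n - 2) / 2\<close> the quadratic equals
      \<open>(n - 2) * (n - 6) / 4\<close>, whence the restriction to
      \<open>n \<ge> 6\<close>.\<close>
    have "0 \<le> (real n - 2) * (real n - 6)" using elim by (intro mult_nonneg_nonneg) auto
    then have "d_star n \<le> (real n - 2) / 2"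
      using elim by (intro d_star_le) (auto simp: power2_eq_square field_simps)
    then have "real ((n - 1) div 2) * of_int \<lfloor>d_star n\<rfloor> \<le> real (cov_threshold n K4_minus)"
      using elim m by (intro cov_threshold_K4_minus_ge_floor) auto
    moreover have "(real n - 2) / 2 * (d_star n - 1) \<le> real ((n - 1) div 2) * of_int \<lfloor>d_star n\<rfloor>"
      using m elim d_star_quadratic(2)[of n] by (intro mult_mono) linarith+
    ultimately have le: "(real n - 2) / 2 * (d_star n - 1) \<le> real (cov_threshold n K4_minus)"
      by linarith
    have "(d_star n - 1) / (real n - 1) =
        (real n - 2) / 2 * (d_star n - 1) * 2 / ((real n - 1) * (real n - 2))"
      using elim by simp
    also have "\<dots> \<le> cov_ratio K4_minus n"
      unfolding ratio[OF \<open>n \<ge> 1\<close>] using elim le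
      by (intro divide_right_mono mult_right_mono) simp_all
    finally show ?case .
  qed
  have inv: "(\<lambda>n. 1 / real n) \<longlonglongrightarrow> 0" by (rule lim_1_over_n)
  have "(\<lambda>n. d_star n / real n / (1 - 2 * (1 / real n))) \<longlonglongrightarrow> (sqrt 13 - 1) / 6 / (1 - 2 * 0)"
    by (intro tendsto_intros d_star_over_n inv) simp
  moreover have "\<forall>\<^sub>F n in sequentially.
      d_star n / real n / (1 - 2 * (1 / real n)) = d_star n / (real n - 2)"
    using eventually_ge_at_top[of 3] by eventually_elim (simp add: field_simps)
  ultimately show "(\<lambda>n. d_star n / (real n - 2)) \<longlonglongrightarrow> (sqrt 13 - 1) / 6"
    using Lim_transform_eventually by fastforce
  have "(\<lambda>n. (d_star n / real n - 1 / real n) / (1 - 1 / real n)) \<longlonglongrightarrow>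
      ((sqrt 13 - 1) / 6 - 0) / (1 - 0)"
    by (intro tendsto_intros d_star_over_n inv) simp
  moreover have "\<forall>\<^sub>F n in sequentially.
      (d_star n / real n - 1 / real n) / (1 - 1 / real n) = (d_star n - 1) / (real n - 1)"
    using eventually_ge_at_top[of 3] by eventually_elim (simp add: field_simps)
  ultimately show "(\<lambda>n. (d_star n - 1) / (real n - 1)) \<longlonglongrightarrow> (sqrt 13 - 1) / 6"
    using Lim_transform_eventually by fastforce
qed

theorem theorem1p1:
  "(\<forall>n::nat. n \<ge> 3 \<and> odd n \<longrightarrow>
      (real n - 1) / 2 * of_int \<lfloor>d_star n\<rfloor> \<le> real (cov_threshold n K4_minus) \<and>
      int (cov_threshold n K4_minus) \<le> \<lfloor>(real n - 1) / 2 * d_star n\<rfloor>) \<and>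
   convergent (cov_ratio K4_minus) \<and>
   cov_density K4_minus = (sqrt 13 - 1) / 6"
proof (intro conjI allI impI)
  fix n :: nat
  assume "n \<ge> 3 \<and> odd n"
  then have n: "n \<ge> 3" "odd n" by auto
  have m: "real ((n - 1) div 2) = (real n - 1) / 2"
    using n by (auto elim!: oddE)
  \<comment> \<open>At \<open>y = (n - 1) / 2\<close> the quadratic equals
    \<open>(n^2 - 9) / 4\<close>, so for odd \<open>n\<close> the construction works from
    \<open>n = 3\<close> on.\<close>
  have "9 \<le> real n * real n" using n mult_mono[of 3 "real n" 3 "real n"] by simp
  then have "d_star n \<le> real ((n - 1) div 2)"
    unfolding m using n by (intro d_star_le) (auto simp: power2_eq_square field_simps)
  then show "(real n - 1) / 2 * of_int \<lfloor>d_star n\<rfloor> \<le> real (cov_threshold n K4_minus)"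
    using cov_threshold_K4_minus_ge_floor[OF n(1)] unfolding m by blast
  show "int (cov_threshold n K4_minus) \<le> \<lfloor>(real n - 1) / 2 * d_star n\<rfloor>"
    using cov_threshold_K4_minus_le[OF n(1)] by (simp add: le_floor_iff)
next
  show "convergent (cov_ratio K4_minus)"
    using cov_ratio_K4_minus_tendsto by (rule convergentI)
  show "cov_density K4_minus = (sqrt 13 - 1) / 6"
    unfolding cov_density_def using cov_ratio_K4_minus_tendsto by (rule limI)
qed

end
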